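(* Let $\lambda$ be the intensity matrix of a Markov process on a finite set $\Omega_0$, let $\{\Gamma_k,k\in K\}$ be a finite nonempty collection of subsets of $\Omega_0$ with $\Omega_0\setminus\bigcup_{k\in K}\Gamma_k\neq\emptyset$, and let $\alpha$ be a probability distribution on $\Omega_0$ (a row vector) putting its full mass on $\Omega_0\setminus\bigcup_{k\in K}\Gamma_k$. If all $\Gamma_k$, $k\in K$, are absorbing, then for every partition $s$ of $K$ and every $t\in R_s$, $$f(\alpha,t,K)=\alpha\left(\prod_{n=1}^{|s|}e^{\lambda(\bar t_n-\bar t_{n-1})}\,\boldsymbol{\lambda}(W_n,T_n)\right)\mathbf 1,$$ where $$f(\alpha,t,K)=\alpha\left(\prod_{n=1}^{|s|}e^{\boldsymbol{\lambda}(W_n)(\bar t_n-\bar t_{n-1})}\,\boldsymbol{\lambda}(W_n,T_n)\right)\mathbf 1 .$$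
   Context: $\lambda$ is an $\Omega_0\times\Omega_0$ real matrix with nonnegative off-diagonal entries and $-\lambda(i,i)=\sum_{j\neq i}\lambda(i,j)$. A nonempty subset $a\subset\Omega_0$ is absorbing if $\lambda(i,j)=0$ for all $i\in a$, $j\in\Omega_0\setminus a$. For $a,b\subset\Omega_0$, $\boldsymbol{\lambda}(a,b)$ is the $\Omega_0\times\Omega_0$ matrix whose $(i,j)$ entry is $\lambda(i,j)$ if $i\in a$, $j\in b$, and $0$ otherwise; $\boldsymbol{\lambda}(a)=\boldsymbol{\lambda}(a,a)$. $\mathbf 1$ is the column vector of ones indexed by $\Omega_0$, and $\prod_{n=1}^mM_n=M_1M_2\cdots M_m$. A partition $s=(s(1),\dots,s(|s|))$ of $K$ is an ordered sequence of disjoint nonempty subsets of $K$ with union $K$; $s(n,1)$ is an (arbitrary) first element of $s(n)$; $L^ms=(s(m+1),\dots,s(|s|))$; for an ordered sequence $s$ of disjoint nonempty subsets of $K$, $S(s)=\bigcup_n\bigcup_{k\in s(n)}\Gamma_k$. $R_s$ is the set of $t\in\mathbb{R}_+^K$ with $t_{k_1}=t_{k_2}$ whenever $k_1,k_2$ are in the same component of $s$, and $t_{s(1,1)}<t_{s(2,1)}<\cdots<t_{s(|s|,1)}$. For $t\in R_s$: $\bar t_n=t_{s(n,1)}$, $\bar t_0=0$, $W_n=\Omega_0\setminus S(L^{n-1}s)$ (with $W_{|s|+1}=\Omega_0$), $T_n=\left[\bigcap_{k\in s(n)}\Gamma_k\right]\cap W_{n+1}$. *)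

theory Defs
  imports "HOL-Analysis.Analysis"
begin

text \<open>The type of square matrices is not an instance of the real normed algebra classes (its
  \<^term>\<open>(*)\<close> is componentwise), so the library's \<^term>\<open>exp\<close> does not apply to it and the
  exponential is defined by its power series with respect to \<^term>\<open>(**)\<close>.\<close>

primrec mat_pow :: "real^'w^'w \<Rightarrow> nat \<Rightarrow> real^'w^'w" where
  "mat_pow A 0 = mat 1"
| "mat_pow A (Suc n) = A ** mat_pow A n"

definition mat_exp :: "real^'w^'w \<Rightarrow> real^'w^'w" where
  "mat_exp A = (\<Sum>n. mat_pow A n /\<^sub>R fact n)"

lemma mat_pow_entry_bound:
  fixes A :: "real^'w^'w"
  assumes A: "\<And>i j. \<bar>A $ i $ j\<bar> \<le> B"
  shows "\<bar>mat_pow A n $ i $ j\<bar> \<le> (real CARD('w) * B) ^ n"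
proof (induction n arbitrary: i)
  case 0
  show ?case by (simp add: mat_def)
next
  case (Suc n)
  have B: "0 \<le> B" using A[of i i] by linarith
  have "\<bar>mat_pow A (Suc n) $ i $ j\<bar> \<le> (\<Sum>k\<in>UNIV. \<bar>A $ i $ k * mat_pow A n $ k $ j\<bar>)"
    by (simp add: matrix_matrix_mult_def sum_abs)
  also have "\<dots> \<le> (\<Sum>k\<in>(UNIV :: 'w set). B * (real CARD('w) * B) ^ n)"
    by (intro sum_mono) (auto simp: abs_mult intro!: mult_mono A Suc.IH B)
  also have "\<dots> = (real CARD('w) * B) ^ Suc n" by simp
  finally show ?case .
qed

lemma mat_exp_sums:
  fixes A :: "real^'w^'w"
  shows "(\<lambda>n. mat_pow A n /\<^sub>R fact n) sums mat_exp A"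
proof -
  define B where "B = (\<Sum>i\<in>UNIV. \<Sum>j\<in>UNIV. \<bar>A $ i $ j\<bar>)"
  define C where "C = real CARD('w) * B"
  have A: "\<bar>A $ i $ j\<bar> \<le> B" for i j
  proof -
    have "\<bar>A $ i $ j\<bar> \<le> (\<Sum>j\<in>UNIV. \<bar>A $ i $ j\<bar>)"
      by (rule member_le_sum) auto
    also have "\<dots> \<le> B" unfolding B_def
      by (rule member_le_sum[where f = "\<lambda>i. \<Sum>j\<in>UNIV. \<bar>A $ i $ j\<bar>"]) (auto intro: sum_nonneg)
    finally show ?thesis .
  qed
  have entry: "summable (\<lambda>n. (mat_pow A n /\<^sub>R fact n) $ i $ j)" for i j
  proof (rule summable_comparison_test')
    show "summable (\<lambda>n. C ^ n /\<^sub>R fact n)" by (rule summable_exp_generic)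
    show "norm ((mat_pow A n /\<^sub>R fact n) $ i $ j) \<le> C ^ n /\<^sub>R fact n" for n
    proof -
      have "norm ((mat_pow A n /\<^sub>R fact n) $ i $ j) = inverse (fact n) * \<bar>mat_pow A n $ i $ j\<bar>"
        by (simp add: abs_mult)
      also have "\<dots> \<le> inverse (fact n) * C ^ n"
        unfolding C_def by (intro mult_left_mono mat_pow_entry_bound A) simp
      finally show ?thesis by simp
    qed
  qed
  define E :: "real^'w^'w" where "E = (\<chi> i j. \<Sum>n. (mat_pow A n /\<^sub>R fact n) $ i $ j)"
  have "(\<lambda>n. mat_pow A n /\<^sub>R fact n) sums E"
    unfolding sums_def
  proof (intro vec_tendstoI)
    fix i j
    have "(\<lambda>n. (mat_pow A n /\<^sub>R fact n) $ i $ j) sums (E $ i $ j)"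
      unfolding E_def using summable_sums[OF entry] by simp
    then show "(\<lambda>m. (\<Sum>n<m. mat_pow A n /\<^sub>R fact n) $ i $ j) \<longlonglongrightarrow> E $ i $ j"
      by (simp add: sums_def)
  qed
  then show ?thesis by (simp add: mat_exp_def sums_iff)
qed

text \<open>\<open>mat_prod M m\<close> is the ordered product \<open>M 1 ** M 2 ** \<dots> ** M m\<close>.\<close>

primrec mat_prod :: "(nat \<Rightarrow> real^'w^'w) \<Rightarrow> nat \<Rightarrow> real^'w^'w" where
  "mat_prod M 0 = mat 1"
| "mat_prod M (Suc m) = mat_prod M m ** M (Suc m)"

definition intensity_matrix :: "real^'w^'w \<Rightarrow> bool" where
  "intensity_matrix lam \<longleftrightarrow>
     (\<forall>i j. i \<noteq> j \<longrightarrow> 0 \<le> lam $ i $ j) \<and> (\<forall>i. - lam $ i $ i = (\<Sum>j\<in>UNIV - {i}. lam $ i $ j))"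

definition absorbing :: "real^'w^'w \<Rightarrow> 'w set \<Rightarrow> bool" where
  "absorbing lam a \<longleftrightarrow> a \<noteq> {} \<and> (\<forall>i\<in>a. \<forall>j\<in>UNIV - a. lam $ i $ j = 0)"

definition block :: "real^'w^'w \<Rightarrow> 'w set \<Rightarrow> 'w set \<Rightarrow> real^'w^'w" where
  "block lam a b = (\<chi> i j. if i \<in> a \<and> j \<in> b then lam $ i $ j else 0)"

definition prob_vector :: "real^'w \<Rightarrow> bool" where
  "prob_vector \<alpha> \<longleftrightarrow> (\<forall>i. 0 \<le> \<alpha> $ i) \<and> (\<Sum>i\<in>UNIV. \<alpha> $ i) = 1"

text \<open>An ordered sequence \<open>s = (s(1), \<dots>, s(|s|))\<close> of sets is a list; \<open>part s n\<close> is the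
  component \<open>s(n)\<close>, numbered from 1. The shifted sequence \<open>L\<^sup>m s\<close> is \<^term>\<open>drop m s\<close>.\<close>

definition ordered_partition :: "'k set \<Rightarrow> 'k set list \<Rightarrow> bool" where
  "ordered_partition K s \<longleftrightarrow>
     (\<forall>a\<in>set s. a \<noteq> {}) \<and>
     (\<forall>m n. m < n \<longrightarrow> n < length s \<longrightarrow> s ! m \<inter> s ! n = {}) \<and>
     \<Union>(set s) = K"

definition part :: "'k set list \<Rightarrow> nat \<Rightarrow> 'k set" where
  "part s n = s ! (n - 1)"

text \<open>An arbitrary element \<open>s(n,1)\<close> of \<open>s(n)\<close>; for \<open>t\<close> in the set \<open>R\<^sub>s\<close> below, its choice does not
  affect the value of \<open>t\<close>.\<close>

definition first_elem :: "'k set list \<Rightarrow> nat \<Rightarrow> 'k" where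
  "first_elem s n = (SOME k. k \<in> part s n)"

text \<open>Elements of \<open>[0, \<infinity>)\<^sup>K\<close> are functions on the index type; only their values on \<open>K\<close> matter.\<close>

definition R_set :: "'k set \<Rightarrow> 'k set list \<Rightarrow> ('k \<Rightarrow> real) set" where
  "R_set K s = {t. (\<forall>k\<in>K. 0 \<le> t k) \<and>
     (\<forall>a\<in>set s. \<forall>k1\<in>a. \<forall>k2\<in>a. t k1 = t k2) \<and>
     (\<forall>n\<in>{1..<length s}. t (first_elem s n) < t (first_elem s (n + 1)))}"

definition tbar :: "('k \<Rightarrow> real) \<Rightarrow> 'k set list \<Rightarrow> nat \<Rightarrow> real" where
  "tbar t s n = (if n = 0 then 0 else t (first_elem s n))"

definition S_set :: "('k \<Rightarrow> 'w set) \<Rightarrow> 'k set list \<Rightarrow> 'w set" where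
  "S_set \<Gamma> s = (\<Union>a\<in>set s. \<Union>k\<in>a. \<Gamma> k)"

definition W_set :: "('k \<Rightarrow> 'w set) \<Rightarrow> 'k set list \<Rightarrow> nat \<Rightarrow> 'w set" where
  "W_set \<Gamma> s n = UNIV - S_set \<Gamma> (drop (n - 1) s)"

definition T_set :: "('k \<Rightarrow> 'w set) \<Rightarrow> 'k set list \<Rightarrow> nat \<Rightarrow> 'w set" where
  "T_set \<Gamma> s n = (\<Inter>k\<in>part s n. \<Gamma> k) \<inter> W_set \<Gamma> s (n + 1)"

text \<open>Every \<open>t\<close> lies in \<open>R_set K s\<close> for at most one ordered partition \<open>s\<close> of \<open>K\<close>, so \<open>f(\<alpha>, t, K)\<close>
  does not need \<open>s\<close> as an argument. Lemma \<open>f_val_eq\<close> gives its formula in terms of any such \<open>s\<close>. The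
  \<open>1\<close> in it is the vector of ones.\<close>

definition partition_of :: "'k set \<Rightarrow> ('k \<Rightarrow> real) \<Rightarrow> 'k set list" where
  "partition_of K t = (THE s. ordered_partition K s \<and> t \<in> R_set K s)"

definition f_val :: "real^'w^'w \<Rightarrow> ('k \<Rightarrow> 'w set) \<Rightarrow> real^'w \<Rightarrow> ('k \<Rightarrow> real) \<Rightarrow> 'k set \<Rightarrow> real" where
  "f_val lam \<Gamma> \<alpha> t K =
     (let s = partition_of K t in
        (\<alpha> v* mat_prod (\<lambda>n.
            mat_exp ((tbar t s n - tbar t s (n - 1)) *\<^sub>R block lam (W_set \<Gamma> s n) (W_set \<Gamma> s n))
            ** block lam (W_set \<Gamma> s n) (T_set \<Gamma> s n)) (length s)) \<bullet> 1)"

lemma partition_of_eq: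
  assumes s: "ordered_partition K s" "t \<in> R_set K s"
  shows "partition_of K t = s"
proof -
  define v where "v = (\<lambda>a. t (SOME k. k \<in> a))"
  have val: "t k = v a" if "ordered_partition K s" "t \<in> R_set K s" "a \<in> set s" "k \<in> a" for s a k
  proof -
    have "(SOME k. k \<in> a) \<in> a" using that(4) by (rule someI)
    then show ?thesis using that(2-4) unfolding v_def R_set_def by blast
  qed
  have image: "set (map v s) = t ` K" if P: "ordered_partition K s" "t \<in> R_set K s" for s
  proof
    show "set (map v s) \<subseteq> t ` K"
    proof
      fix x assume "x \<in> set (map v s)"
      then obtain a where a: "a \<in> set s" "x = v a" by auto
      then obtain k where "k \<in> a" using P(1) unfolding ordered_partition_def by blast
      then have "k \<in> K" "t k = x"
        using P(1) a val[OF P a(1)] by (auto simp: ordered_partition_def)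
      then show "x \<in> t ` K" by blast
    qed
    show "t ` K \<subseteq> set (map v s)"
    proof
      fix x assume "x \<in> t ` K"
      then obtain k where k: "k \<in> K" "x = t k" by blast
      then obtain a where a: "a \<in> set s" "k \<in> a"
        using P(1) unfolding ordered_partition_def by blast
      then show "x \<in> set (map v s)" using val[OF P a] k(2) by simp
    qed
  qed
  have sorted: "sorted_wrt (<) (map v s)" if P: "ordered_partition K s" "t \<in> R_set K s" for s
  proof -
    have "v (s ! i) < v (s ! Suc i)" if "Suc i < length s" for i
    proof -
      have "Suc i \<in> {1..<length s}" using that by simp
      then have "t (first_elem s (Suc i)) < t (first_elem s (Suc i + 1))"
        using P(2) unfolding R_set_def by blast
      then show ?thesis by (simp add: v_def first_elem_def part_def)
    qed
    then show ?thesis by (subst sorted_wrt_iff_nth_Suc_transp) auto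
  qed
  have level: "a = {k \<in> K. t k = v a}"
    if P: "ordered_partition K s" "t \<in> R_set K s" "a \<in> set s" for s a
  proof -
    have "distinct (map v s)"
      using sorted[OF P(1,2)] by (simp only: strict_sorted_iff)
    then have inj: "inj_on v (set s)" by (simp only: distinct_map)
    show ?thesis
    proof
      show "a \<subseteq> {k \<in> K. t k = v a}"
        using P val[OF P] unfolding ordered_partition_def by blast
      show "{k \<in> K. t k = v a} \<subseteq> a"
      proof
        fix k assume k: "k \<in> {k \<in> K. t k = v a}"
        then obtain b where b: "b \<in> set s" "k \<in> b"
          using P(1) unfolding ordered_partition_def by blast
        then have "v b = v a" using val[OF P(1,2) b] k by simp
        then have "b = a" using inj b(1) P(3) by (simp only: inj_on_eq_iff)
        then show "k \<in> a" using b(2) by simp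
      qed
    qed
  qed
  have recover: "s = map (\<lambda>x. {k \<in> K. t k = x}) (map v s)"
    if P: "ordered_partition K s" "t \<in> R_set K s" for s
  proof -
    have "map (\<lambda>a. {k \<in> K. t k = v a}) s = s"
      by (rule map_idI) (rule level[OF P, symmetric])
    then show ?thesis by (simp add: o_def)
  qed
  have "s' = s" if P: "ordered_partition K s'" "t \<in> R_set K s'" for s'
  proof -
    have "map v s' = map v s"
      by (rule strict_sorted_equal[OF sorted[OF s] sorted[OF P]]) (simp only: image[OF P] image[OF s])
    then show ?thesis using recover[OF P] recover[OF s] by metis
  qed
  then show ?thesis unfolding partition_of_def by (intro the_equality) (simp_all only: s)
qed

lemma f_val_eq:
  assumes "ordered_partition K s" "t \<in> R_set K s"
  shows "f_val lam \<Gamma> \<alpha> t K =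
     (\<alpha> v* mat_prod (\<lambda>n.
        mat_exp ((tbar t s n - tbar t s (n - 1)) *\<^sub>R block lam (W_set \<Gamma> s n) (W_set \<Gamma> s n))
        ** block lam (W_set \<Gamma> s n) (T_set \<Gamma> s n)) (length s)) \<bullet> 1"
  by (simp add: f_val_def partition_of_eq[OF assms])

end

theory Submission
  imports Defs
begin

text \<open>The complement of each \<open>W\<^sub>n\<close> is a union of absorbing sets, so the process cannot enter \<open>W\<^sub>n\<close>
  from outside. On matrices whose rows outside \<open>W\<^sub>n\<close> vanish, such as \<open>\<^bold>\<lambda>(W\<^sub>n, T\<^sub>n)\<close>, left multiplication
  by \<open>\<lambda>\<close> therefore agrees with left multiplication by \<open>\<^bold>\<lambda>(W\<^sub>n)\<close> and stays inside this space of
  matrices. Hence the powers, and so the exponentials, act identically too, and the two products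
  agree factor by factor.\<close>

text \<open>In the sum for an entry of \<open>A ** X\<close>, terms with inner index outside
  \<open>W\<close> vanish because of \<open>X\<close>; in a row outside \<open>W\<close> the
  remaining ones vanish because of \<open>A\<close>.\<close>

lemma matrix_mult_block_rows:
  fixes A X :: "real^'w^'w"
  assumes A: "\<And>i j. i \<notin> W \<Longrightarrow> j \<in> W \<Longrightarrow> A $ i $ j = 0"
    and X: "\<And>i j. i \<notin> W \<Longrightarrow> X $ i $ j = 0"
  shows "A ** X = block A W W ** X"
    and "i \<notin> W \<Longrightarrow> (A ** X) $ i $ j = 0"
proof -
  show "A ** X = block A W W ** X"
    unfolding vec_eq_iff matrix_matrix_mult_def block_def
    using assms by (force intro!: sum.cong)
  show "(A ** X) $ i $ j = 0" if "i \<notin> W"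
    unfolding matrix_matrix_mult_def
    using assms that by (force intro!: sum.neutral)
qed

text \<open>The second conjunct strengthens the induction: it lets the one-step lemma apply to
  \<open>mat_pow A n ** X\<close> in place of \<open>X\<close>.\<close>

lemma mat_pow_mult_block_rows:
  fixes A X :: "real^'w^'w"
  assumes A: "\<And>i j. i \<notin> W \<Longrightarrow> j \<in> W \<Longrightarrow> A $ i $ j = 0"
    and X: "\<And>i j. i \<notin> W \<Longrightarrow> X $ i $ j = 0"
  shows "mat_pow A n ** X = mat_pow (block A W W) n ** X
    \<and> (\<forall>i j. i \<notin> W \<longrightarrow> (mat_pow A n ** X) $ i $ j = 0)"
proof (induction n)
  case 0
  show ?case using X by simp
next
  case (Suc n)
  have rows: "\<And>i j. i \<notin> W \<Longrightarrow> (mat_pow A n ** X) $ i $ j = 0"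
    using Suc by blast
  from matrix_mult_block_rows[OF A rows] Suc show ?case
    by (simp add: matrix_mul_assoc[symmetric])
qed

text \<open>Right multiplication by \<open>X\<close> is linear, hence continuous in finite
  dimension, and so passes through the exponential series.\<close>

lemma mat_exp_mult_sums:
  fixes A X :: "real^'w^'w"
  shows "(\<lambda>n. (mat_pow A n ** X) /\<^sub>R fact n) sums (mat_exp A ** X)"
proof -
  have "linear (\<lambda>M :: real^'w^'w. M ** X)"
    by (intro linearI)
      (simp_all add: vec_eq_iff matrix_matrix_mult_def sum.distrib sum_distrib_left algebra_simps)
  then have lin: "bounded_linear (\<lambda>M :: real^'w^'w. M ** X)"
    by (simp add: linear_conv_bounded_linear)
  show ?thesis
    using bounded_linear.sums[OF lin mat_exp_sums[of A]]
    by (simp add: linear_simps[OF lin])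
qed

lemma mat_exp_mult_block_rows:
  fixes A X :: "real^'w^'w"
  assumes "\<And>i j. i \<notin> W \<Longrightarrow> j \<in> W \<Longrightarrow> A $ i $ j = 0"
    and "\<And>i j. i \<notin> W \<Longrightarrow> X $ i $ j = 0"
  shows "mat_exp A ** X = mat_exp (block A W W) ** X"
proof -
  have "mat_pow A n ** X = mat_pow (block A W W) n ** X" for n
    using mat_pow_mult_block_rows[of W A X n] assms by blast
  then show ?thesis
    using mat_exp_mult_sums[of A X] mat_exp_mult_sums[of "block A W W" X]
    by (simp add: sums_unique2)
qed

lemma block_scaleR: "block (c *\<^sub>R A) a b = c *\<^sub>R block A a b"
  by (simp add: vec_eq_iff block_def)

text \<open>Some absorbing \<open>\<Gamma> k\<close> from the tail of \<open>s\<close> contains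
  \<open>i\<close>, while \<open>j\<close> avoids all of them.\<close>

lemma absorbing_W_set:
  assumes s: "ordered_partition K s" and \<Gamma>: "\<forall>k\<in>K. absorbing lam (\<Gamma> k)"
    and ij: "i \<notin> W_set \<Gamma> s n" "j \<in> W_set \<Gamma> s n"
  shows "lam $ i $ j = 0"
proof -
  from ij obtain a k where a: "a \<in> set (drop (n - 1) s)" and k: "k \<in> a" "i \<in> \<Gamma> k" "j \<notin> \<Gamma> k"
    by (auto simp: W_set_def S_set_def)
  from a have "a \<in> set s" by (rule in_set_dropD)
  with s k(1) have "k \<in> K" by (auto simp: ordered_partition_def)
  with \<Gamma> k(2,3) show ?thesis by (auto simp: absorbing_def)
qed

theorem proposition4p2:
  fixes lam :: "real^'w^'w"
    and K :: "'k set"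
    and \<Gamma> :: "'k \<Rightarrow> 'w set"
    and \<alpha> :: "real^'w"
  assumes "intensity_matrix lam"
    and "finite K" and "K \<noteq> {}"
    and "UNIV - (\<Union>k\<in>K. \<Gamma> k) \<noteq> {}"
    and "prob_vector \<alpha>"
    and "(\<Sum>i\<in>UNIV - (\<Union>k\<in>K. \<Gamma> k). \<alpha> $ i) = 1"
    and "\<forall>k\<in>K. absorbing lam (\<Gamma> k)"
  shows "\<forall>s t. ordered_partition K s \<longrightarrow> t \<in> R_set K s \<longrightarrow>
    f_val lam \<Gamma> \<alpha> t K =
      (\<alpha> v* mat_prod (\<lambda>n.
          mat_exp ((tbar t s n - tbar t s (n - 1)) *\<^sub>R lam)
          ** block lam (W_set \<Gamma> s n) (T_set \<Gamma> s n)) (length s)) \<bullet> 1"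
proof (intro allI impI)
  fix s t
  assume s: "ordered_partition K s" and t: "t \<in> R_set K s"
  have "mat_exp (c *\<^sub>R block lam (W_set \<Gamma> s n) (W_set \<Gamma> s n)) ** block lam (W_set \<Gamma> s n) (T_set \<Gamma> s n)
      = mat_exp (c *\<^sub>R lam) ** block lam (W_set \<Gamma> s n) (T_set \<Gamma> s n)" for c n
    \<comment> \<open>With the scalar inside \<open>block\<close>, the lemma applies to
      \<open>c *\<^sub>R lam\<close>, which keeps the zero entries of \<open>lam\<close>.\<close>
    unfolding block_scaleR[symmetric]
    by (rule mat_exp_mult_block_rows[symmetric])
      (simp_all add: absorbing_W_set[OF s assms(7)] block_def)
  then show "f_val lam \<Gamma> \<alpha> t K =
      (\<alpha> v* mat_prod (\<lambda>n.
          mat_exp ((tbar t s n - tbar t s (n - 1)) *\<^sub>R lam)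
          ** block lam (W_set \<Gamma> s n) (T_set \<Gamma> s n)) (length s)) \<bullet> 1"
    by (simp only: f_val_eq[OF s t])
qed

end
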